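(* Let $E$ be a Banach space and $p\in[1,\infty]$. Then $\operatorname{FVL}[E]$ is order dense in $\operatorname{FBL}^{(p)}[E]$ if and only if $E$ is finite-dimensional.
   Context: Banach spaces are real. For a Banach space $E$ with dual $E^{*}$ and closed unit ball $B_E$, $H[E]$ denotes the vector lattice (pointwise operations and order) of all positively homogeneous functions $f:E^{*}\to\mathbb{R}$, i.e. $f(\lambda x^{*})=\lambda f(x^{*})$ for all $\lambda\ge 0$, $x^{*}\in E^{*}$. For $x\in E$ let $\delta_x\in H[E]$ be $\delta_x(x^{*})=x^{*}(x)$, and let $\delta_E:E\to H[E]$, $\delta_E(x)=\delta_x$. The free vector lattice $\operatorname{FVL}[E]$ is the vector sublattice of $H[E]$ generated (algebraically, by finitely many linear and lattice operations) by $\delta_E(E)$. For $1\le p<\infty$ and $f\in H[E]$ put $$\|f\|_{\operatorname{FBL}^{(p)}[E]}=\sup\Big\{\Big(\sum_k|f(x_k^{*})|^p\Big)^{1/p}\Big\},$$ the supremum being over all finite sequences $(x_k^{*})$ in $E^{*}$ with $\sum_k|x_k^{*}(x)|^p\le 1$ for all $x\in B_E$; for $p=\infty$ put $\|f\|_{\operatorname{FBL}^{(\infty)}[E]}=\sup_{x^{*}\in B_{E^{*}}}|f(x^{*})|$. Let $H^{p}[E]=\{f\in H[E]:\|f\|_{\operatorname{FBL}^{(p)}[E]}<\infty\}$, a Banach lattice. The free $p$-convex Banach lattice $\operatorname{FBL}^{(p)}[E]$ is the norm-closed sublattice of $H^{p}[E]$ generated by $\delta_E(E)$, i.e. the norm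 closure of $\operatorname{FVL}[E]$ in $H^p[E]$. A vector sublattice $Y$ of a vector lattice $X$ is order dense in $X$ if for every $0<f\in X$ there is $g\in Y$ with $0<g\le f$ (where $f>0$ means $f\ge 0$ and $f\ne 0$). *)

theory Defs
  imports "HOL-Analysis.Analysis"
begin

text \<open>
  The dual of a real Banach space of type \<open>'a\<close> is the type \<open>'a \<Rightarrow>\<^sub>L real\<close> with the operator norm.
  Elements of \<open>H[E]\<close> and of its sublattices are functions on the dual; order and lattice
  operations are the pointwise ones on the function type.
\<close>

definition pos_homogeneous :: "(('a::banach \<Rightarrow>\<^sub>L real) \<Rightarrow> real) set" where
  "pos_homogeneous = {f. \<forall>c\<ge>0. \<forall>\<phi>. f (c *\<^sub>R \<phi>) = c * f \<phi>}"

definition eval_at :: "'a::banach \<Rightarrow> ('a \<Rightarrow>\<^sub>L real) \<Rightarrow> real" where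
  "eval_at x = (\<lambda>\<phi>. blinfun_apply \<phi> x)"

definition vector_sublattice :: "('b \<Rightarrow> real) set \<Rightarrow> ('b \<Rightarrow> real) set \<Rightarrow> bool" where
  "vector_sublattice Y X \<longleftrightarrow>
     Y \<subseteq> X \<and>
     (\<lambda>_. 0) \<in> Y \<and>
     (\<forall>f\<in>Y. \<forall>g\<in>Y. (\<lambda>t. f t + g t) \<in> Y) \<and>
     (\<forall>c. \<forall>f\<in>Y. (\<lambda>t. c * f t) \<in> Y) \<and>
     (\<forall>f\<in>Y. \<forall>g\<in>Y. sup f g \<in> Y \<and> inf f g \<in> Y)"

definition FVL :: "(('a::banach \<Rightarrow>\<^sub>L real) \<Rightarrow> real) set" where
  "FVL = (\<lambda>Y. vector_sublattice Y pos_homogeneous) hull range eval_at"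

text \<open>
  Finite sequences in the dual are lists, so repetitions are allowed. The norm takes values in
  \<open>[0, \<infinity>]\<close>; for \<open>p < \<infinity>\<close> the exponent is the real number \<open>enn2real p\<close>.
\<close>

definition weakly_p_bounded :: "real \<Rightarrow> ('a::banach \<Rightarrow>\<^sub>L real) list set" where
  "weakly_p_bounded q =
     {\<phi>s. \<forall>x\<in>cball 0 1. (\<Sum>\<phi>\<leftarrow>\<phi>s. \<bar>blinfun_apply \<phi> x\<bar> powr q) \<le> 1}"

definition FBL_norm :: "ennreal \<Rightarrow> (('a::banach \<Rightarrow>\<^sub>L real) \<Rightarrow> real) \<Rightarrow> ennreal" where
  "FBL_norm p f =
     (if p = \<infinity> then SUP \<phi>\<in>cball 0 1. ennreal \<bar>f \<phi>\<bar>
      else SUP \<phi>s\<in>weakly_p_bounded (enn2real p).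
             ennreal ((\<Sum>\<phi>\<leftarrow>\<phi>s. \<bar>f \<phi>\<bar> powr enn2real p) powr (1 / enn2real p)))"

definition Hp :: "ennreal \<Rightarrow> (('a::banach \<Rightarrow>\<^sub>L real) \<Rightarrow> real) set" where
  "Hp p = {f \<in> pos_homogeneous. FBL_norm p f < \<infinity>}"

definition FBL :: "ennreal \<Rightarrow> (('a::banach \<Rightarrow>\<^sub>L real) \<Rightarrow> real) set" where
  "FBL p = {f \<in> Hp p. \<forall>\<epsilon>>0. \<exists>g\<in>FVL. FBL_norm p (\<lambda>\<phi>. f \<phi> - g \<phi>) < \<epsilon>}"

text \<open>
  The strict pointwise order on functions, \<open>0 < f\<close>, means \<open>0 \<le> f\<close> and \<open>f \<noteq> 0\<close>.
\<close>

definition order_dense :: "('b \<Rightarrow> real) set \<Rightarrow> ('b \<Rightarrow> real) set \<Rightarrow> bool" where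
  "order_dense Y X \<longleftrightarrow>
     vector_sublattice Y X \<and>
     (\<forall>f\<in>X. (\<lambda>_. 0) < f \<longrightarrow> (\<exists>g\<in>Y. (\<lambda>_. 0) < g \<and> g \<le> f))"

end

theory Submission
  imports Defs
begin

text \<open>
  If \<open>E\<close> is finite-dimensional, elements of \<open>FBL p\<close> are continuous on the dual ball, so a positive one
  exceeds some \<open>\<epsilon>\<close> near a point \<open>\<phi>0\<close>; as finitely many coordinates control the dual norm, a positive
  part of a combination of evaluations and their absolute values is supported on a thin cone around
  \<open>\<phi>0\<close> and lies below.

  If \<open>E\<close> is infinite-dimensional, take unit vectors \<open>e n\<close> not contained in the span of any finite set
  and \<open>f \<phi> = max 0 (\<bar>\<phi> u\<bar> - (\<Sum>n. 4\<^sup>-\<^sup>n\<^sup>-\<^sup>1 \<bar>\<phi> (e n)\<bar>))\<close>, where \<open>u\<close> is a multiple of \<open>e 0\<close> making \<open>f\<close> nonzero.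
  An element \<open>g\<close> of \<open>FVL\<close> depends on the values of \<open>\<phi>\<close> at finitely many points only. By Hahn-Banach,
  \<open>\<phi>\<close> can be changed without affecting these values or \<open>\<phi> u\<close> so that some \<open>\<bar>\<phi> (e n)\<bar>\<close> becomes large
  enough to kill \<open>f\<close>; hence \<open>0 \<le> g \<le> f\<close> forces \<open>g = 0\<close>.
\<close>

section \<open>Separation from finite-dimensional subspaces\<close>

text \<open>Tychonoff's theorem: the box is \<open>PiE UNIV K\<close>, and the topology of the
  function type is the product topology.\<close>

lemma compact_function_box:
  fixes K :: "'i \<Rightarrow> 'b::topological_space set"
  assumes "\<And>i. compact (K i)"
  shows "compact {c. \<forall>i. c i \<in> K i}"
proof -
  have "{c. \<forall>i. c i \<in> K i} = PiE UNIV K"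
    by (auto simp: PiE_def)
  moreover have "compactin (product_topology (\<lambda>i. euclidean) UNIV) (PiE UNIV K)"
    using assms by (subst compactin_PiE) auto
  ultimately show ?thesis
    by (simp add: euclidean_product_topology)
qed

text \<open>The norm of the combination attains its minimum \<open>m\<close> on the compact
  l1-sphere of coefficients. Independence gives \<open>m > 0\<close>, and scaling gives
  \<open>C = 1 / m\<close>.\<close>

lemma independent_coefficients_bound:
  fixes B :: "'a::real_normed_vector set"
  assumes "finite B" "independent B"
  obtains C where "C > 0" "\<And>c. (\<Sum>b\<in>B. \<bar>c b\<bar>) \<le> C * norm (\<Sum>b\<in>B. c b *\<^sub>R b)"
proof (cases "B = {}")
  case True
  then show ?thesis using that[of 1] by simp
next
  case False
  \<comment> \<open>Coefficients are functions on the whole type; pinning them to 0 outside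
    \<open>B\<close> makes the sphere a closed part of a compact box.\<close>
  define K :: "('a \<Rightarrow> real) set" where
    "K = {c. \<forall>i. c i \<in> (if i \<in> B then {-1..1} else {0})} \<inter> {c. (\<Sum>b\<in>B. \<bar>c b\<bar>) = 1}"
  have cont: "continuous_on S (\<lambda>c::'a \<Rightarrow> real. c b)" for S b
    by (rule continuous_on_subset[OF continuous_on_product_coordinates subset_UNIV])
  have contN: "continuous_on S (\<lambda>c. norm (\<Sum>b\<in>B. c b *\<^sub>R b))" for S
    by (intro continuous_intros cont)
  have "closed {c::'a \<Rightarrow> real. (\<Sum>b\<in>B. \<bar>c b\<bar>) = 1}"
    by (intro closed_Collect_eq continuous_intros cont)
  moreover have "compact {c::'a \<Rightarrow> real. \<forall>i. c i \<in> (if i \<in> B then {-1..1} else {0})}"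
    by (rule compact_function_box) auto
  ultimately have "compact K"
    unfolding K_def by (simp add: compact_Int_closed)
  moreover have normalised: "(\<lambda>i. if i \<in> B then c i / (\<Sum>b\<in>B. \<bar>c b\<bar>) else 0) \<in> K"
    if "(\<Sum>b\<in>B. \<bar>c b\<bar>) \<noteq> 0" for c
  proof -
    let ?s = "\<Sum>b\<in>B. \<bar>c b\<bar>"
    have s: "?s > 0" using that by (simp add: less_le sum_nonneg)
    have "\<bar>c i\<bar> \<le> ?s" if "i \<in> B" for i
      using assms(1) that by (intro member_le_sum) auto
    then have "\<bar>c i / ?s\<bar> \<le> 1" if "i \<in> B" for i
      using s that by (auto simp: abs_divide divide_le_eq_1 abs_of_pos)
    then have "-1 \<le> c i / ?s \<and> c i / ?s \<le> 1" if "i \<in> B" for i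
      using that by (metis abs_le_iff minus_le_iff)
    moreover have "(\<Sum>b\<in>B. \<bar>c b / ?s\<bar>) = 1"
      using s by (simp add: abs_divide flip: sum_divide_distrib)
    ultimately show ?thesis unfolding K_def by simp
  qed
  moreover have "K \<noteq> {}"
    using normalised[of "\<lambda>_. 1"] False assms(1) by auto
  ultimately obtain c0 where c0: "c0 \<in> K"
    and min: "\<And>c. c \<in> K \<Longrightarrow> norm (\<Sum>b\<in>B. c0 b *\<^sub>R b) \<le> norm (\<Sum>b\<in>B. c b *\<^sub>R b)"
    using continuous_attains_inf[of K "\<lambda>c. norm (\<Sum>b\<in>B. c b *\<^sub>R b)"]
    by (metis contN)
  define m where "m = norm (\<Sum>b\<in>B. c0 b *\<^sub>R b)"
  have "m \<noteq> 0"
  proof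
    assume "m = 0"
    then have "\<forall>b\<in>B. c0 b = 0"
      using independentD[OF assms(2,1) subset_refl] by (auto simp: m_def)
    then show False using c0 by (simp add: K_def)
  qed
  then have "m > 0" by (simp add: m_def)
  have "(\<Sum>b\<in>B. \<bar>c b\<bar>) \<le> 1 / m * norm (\<Sum>b\<in>B. c b *\<^sub>R b)" for c
  proof (cases "(\<Sum>b\<in>B. \<bar>c b\<bar>) = 0")
    case True
    then show ?thesis using \<open>m > 0\<close> by simp
  next
    case False
    let ?s = "\<Sum>b\<in>B. \<bar>c b\<bar>"
    have s: "?s > 0" using False by (simp add: less_le sum_nonneg)
    have "m \<le> norm (\<Sum>b\<in>B. (c b / ?s) *\<^sub>R b)"
      using min[OF normalised[OF False]] by (simp add: m_def)
    also have "(\<Sum>b\<in>B. (c b / ?s) *\<^sub>R b) = (1 / ?s) *\<^sub>R (\<Sum>b\<in>B. c b *\<^sub>R b)"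
      by (simp add: scaleR_sum_right)
    also have "norm \<dots> = norm (\<Sum>b\<in>B. c b *\<^sub>R b) / ?s"
      using s by simp
    finally show ?thesis using s \<open>m > 0\<close> by (simp add: field_simps)
  qed
  then show ?thesis using that[of "1 / m"] \<open>m > 0\<close> by simp
qed

section \<open>Sublinear functionals and the Hahn-Banach theorem\<close>

text \<open>Scaling is required only as an inequality, which passes easily to infima;
  \<open>sublinear_scale\<close> recovers equality.\<close>

definition sublinear :: "('a::real_vector \<Rightarrow> real) \<Rightarrow> bool" where
  "sublinear q \<longleftrightarrow> (\<forall>x y. q (x + y) \<le> q x + q y) \<and> (\<forall>t\<ge>0. \<forall>x. q (t *\<^sub>R x) \<le> t * q x)"

lemma sublinear_zero: "sublinear q \<Longrightarrow> q 0 = 0"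
proof -
  assume q: "sublinear q"
  then have "q (0 + 0) \<le> q 0 + q 0" "q (0 *\<^sub>R 0) \<le> 0 * q 0"
    unfolding sublinear_def by blast+
  then show ?thesis by simp
qed

lemma sublinear_minus: "sublinear q \<Longrightarrow> - q (- x) \<le> q x"
proof -
  assume q: "sublinear q"
  then have "q (x + - x) \<le> q x + q (- x)" unfolding sublinear_def by blast
  then show ?thesis using sublinear_zero[OF q] by simp
qed

text \<open>The reverse inequality is the given one with factor \<open>1 / t\<close> at the point
  \<open>t *\<^sub>R x\<close>.\<close>

lemma sublinear_scale:
  assumes "sublinear q" "t \<ge> 0"
  shows "q (t *\<^sub>R x) = t * q x"
proof (cases "t = 0")
  case True
  then show ?thesis using sublinear_zero[OF assms(1)] by simp
next
  case False
  then have "t > 0" using assms(2) by simp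
  have "q ((1 / t) *\<^sub>R (t *\<^sub>R x)) \<le> 1 / t * q (t *\<^sub>R x)"
    using assms unfolding sublinear_def by (meson divide_nonneg_nonneg zero_le_one)
  then have "t * q x \<le> q (t *\<^sub>R x)"
    using \<open>t > 0\<close> by (simp add: field_simps)
  moreover have "q (t *\<^sub>R x) \<le> t * q x"
    using assms unfolding sublinear_def by blast
  ultimately show ?thesis by simp
qed

text \<open>The members \<open>Q i\<close> need not be sublinear: each inequality may be met by
  another index \<open>k\<close>. This covers shifts, chains and distances to a subspace
  alike.\<close>

lemma sublinear_INF:
  fixes Q :: "'i \<Rightarrow> 'a::real_vector \<Rightarrow> real"
  assumes "I \<noteq> {}"
    and bdd: "\<And>x. bdd_below ((\<lambda>i. Q i x) ` I)"
    and add: "\<And>i j x y. i \<in> I \<Longrightarrow> j \<in> I \<Longrightarrow> \<exists>k\<in>I. Q k (x + y) \<le> Q i x + Q j y"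
    and scale: "\<And>i t x. i \<in> I \<Longrightarrow> t > 0 \<Longrightarrow> \<exists>k\<in>I. Q k (t *\<^sub>R x) \<le> t * Q i x"
    and zero: "\<exists>k\<in>I. Q k 0 \<le> 0"
  shows "sublinear (\<lambda>x. INF i\<in>I. Q i x)"
proof -
  have le: "(INF i\<in>I. Q i x) \<le> c" if "\<exists>k\<in>I. Q k x \<le> c" for x c
    using that cINF_lower2[OF bdd] by blast
  have 1: "(INF i\<in>I. Q i (x + y)) \<le> (INF i\<in>I. Q i x) + (INF i\<in>I. Q i y)" for x y
  proof -
    have "(INF i\<in>I. Q i (x + y)) - Q j y \<le> (INF i\<in>I. Q i x)" if "j \<in> I" for j
      using le[OF add[OF _ that]] by (intro cINF_greatest[OF assms(1)]) (simp add: diff_le_eq)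
    then have "(INF i\<in>I. Q i (x + y)) - (INF i\<in>I. Q i x) \<le> (INF i\<in>I. Q i y)"
      by (intro cINF_greatest[OF assms(1)]) (simp add: algebra_simps)
    then show ?thesis by simp
  qed
  have 2: "(INF i\<in>I. Q i (t *\<^sub>R x)) \<le> t * (INF i\<in>I. Q i x)" if "t \<ge> 0" for t x
  proof (cases "t = 0")
    case True
    then show ?thesis using le[OF zero] by simp
  next
    case False
    then have "t > 0" using that by simp
    then have "(INF i\<in>I. Q i (t *\<^sub>R x)) / t \<le> (INF i\<in>I. Q i x)"
      using le[OF scale] by (intro cINF_greatest[OF assms(1)]) (simp add: field_simps)
    then show ?thesis using \<open>t > 0\<close> by (simp add: field_simps)
  qed
  show ?thesis using 1 2 by (simp add: sublinear_def)
qed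

text \<open>The functional is the infimum of \<open>q (x + t *\<^sub>R y) - t * q y\<close> over
  \<open>t \<ge> 0\<close>. The index 0 yields \<open>q' \<le> q\<close> and the index 1 the shifted
  bound.\<close>

lemma sublinear_shift:
  assumes "sublinear q"
  obtains q' where "sublinear q'" "q' \<le> q" "\<And>x. q' x \<le> q (x + y) - q y"
proof -
  define Q where "Q t x = q (x + t *\<^sub>R y) - t * q y" for t x
  have sub: "q (x + y) \<le> q x + q y" for x y
    using assms by (simp add: sublinear_def)
  \<comment> \<open>Subadditivity on \<open>t *\<^sub>R y = (x + t *\<^sub>R y) + (- x)\<close>
    gives a lower bound independent of \<open>t\<close>, so the infimum is finite.\<close>
  have low: "- q (- x) \<le> Q t x" if "t \<ge> 0" for t x
    using sub[of "x + t *\<^sub>R y" "- x"] sublinear_scale[OF assms that, of y]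
    by (simp add: Q_def)
  have bdd: "bdd_below ((\<lambda>t. Q t x) ` {0..})" for x
    using low by (intro bdd_belowI2[of _ "- q (- x)"]) auto
  have "sublinear (\<lambda>x. INF t\<in>{0..}. Q t x)"
  proof (rule sublinear_INF)
    show "\<exists>k\<in>{0..}. Q k (x + z) \<le> Q i x + Q j z" if "i \<in> {0..}" "j \<in> {0..}" for i j x z
      using that sub[of "x + i *\<^sub>R y" "z + j *\<^sub>R y"]
      by (intro bexI[of _ "i + j"]) (auto simp: Q_def algebra_simps)
    show "\<exists>k\<in>{0..}. Q k (t *\<^sub>R x) \<le> t * Q i x" if "i \<in> {0..}" "t > 0" for i t x
      using that sublinear_scale[OF assms, of t "x + i *\<^sub>R y"]
      by (intro bexI[of _ "t * i"]) (auto simp: Q_def algebra_simps)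
    show "\<exists>k\<in>{0..}. Q k 0 \<le> 0"
      using sublinear_zero[OF assms] by (intro bexI[of _ 0]) (auto simp: Q_def)
  qed (use bdd in auto)
  moreover have "(INF t\<in>{0..}. Q t x) \<le> Q s x" if "s \<ge> 0" for s x
    using that by (intro cINF_lower bdd) auto
  from this[of 0] this[of 1] have "(\<lambda>x. INF t\<in>{0..}. Q t x) \<le> q"
    and "\<And>x. (INF t\<in>{0..}. Q t x) \<le> q (x + y) - q y"
    by (auto simp: Q_def le_fun_def)
  ultimately show ?thesis using that by blast
qed

text \<open>Zorn's lemma, with the pointwise infimum as lower bound of a nonempty chain.\<close>

lemma minimal_sublinear_exists:
  assumes "sublinear p"
  obtains m where "sublinear m" "m \<le> p" "\<And>q. sublinear q \<Longrightarrow> q \<le> m \<Longrightarrow> q = m"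
proof -
  let ?A = "{q. sublinear q \<and> q \<le> p}"
  \<comment> \<open>The order is reversed, so that the maximal element from Zorn's lemma is a
    minimal functional.\<close>
  let ?P = "\<lambda>f g::'a \<Rightarrow> real. g \<le> f"
  have "\<exists>m\<in>?A. \<forall>a\<in>?A. ?P m a \<longrightarrow> a = m"
  proof (rule predicate_Zorn)
    show "partial_order_on ?A (relation_of ?P ?A)"
      by (rule partial_order_on_relation_ofI) auto
  next
    fix C assume "C \<in> Chains (relation_of ?P ?A)"
    then have C: "C \<subseteq> ?A" and chain: "\<And>f g. f \<in> C \<Longrightarrow> g \<in> C \<Longrightarrow> f \<le> g \<or> g \<le> f"
      by (auto simp: Chains_def relation_of_def)
    show "\<exists>u\<in>?A. \<forall>a\<in>C. u \<le> a"
    proof (cases "C = {}")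
      case True
      then show ?thesis using assms by auto
    next
      case False
      \<comment> \<open>All members of the chain lie below \<open>p\<close>, so
        \<open>- p (- x)\<close> bounds their values at \<open>x\<close> from below.\<close>
      have low: "- p (- x) \<le> q x" if "q \<in> C" for q x
      proof -
        have "sublinear q" "q (- x) \<le> p (- x)" using C that by (auto simp: le_fun_def)
        then show ?thesis using sublinear_minus[of q x] by linarith
      qed
      then have bdd: "bdd_below ((\<lambda>q. q x) ` C)" for x
        by (rule bdd_belowI2)
      have sl: "\<And>q. q \<in> C \<Longrightarrow> sublinear q" using C by blast
      have "sublinear (\<lambda>x. INF q\<in>C. q x)"
      proof (rule sublinear_INF[OF False bdd])
        show "\<exists>k\<in>C. k (x + y) \<le> f x + g y" if "f \<in> C" "g \<in> C" for f g x y
        proof -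
          \<comment> \<open>The smaller of two chain members serves at both arguments, so its own
            subadditivity suffices.\<close>
          have "\<exists>k\<in>C. k \<le> f \<and> k \<le> g" using chain that by blast
          then obtain k where k: "k \<in> C" "k x \<le> f x" "k y \<le> g y" by (auto simp: le_fun_def)
          have "k (x + y) \<le> k x + k y" using sl[OF k(1)] by (simp add: sublinear_def)
          then show ?thesis using k by (intro bexI[of _ k]) auto
        qed
        show "\<exists>k\<in>C. k (t *\<^sub>R x) \<le> t * f x" if "f \<in> C" "t > 0" for f t x
          using that sl[of f] by (auto simp: sublinear_def intro!: bexI[of _ f])
        show "\<exists>k\<in>C. k 0 \<le> 0" using False sl sublinear_zero by fastforce
      qed
      moreover have lower: "(\<lambda>x. INF q\<in>C. q x) \<le> a" if "a \<in> C" for a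
        using that by (auto simp: le_fun_def intro!: cINF_lower bdd)
      moreover have "(\<lambda>x. INF q\<in>C. q x) \<le> p"
        using False C lower by (metis (mono_tags, lifting) all_not_in_conv mem_Collect_eq order_trans subsetD)
      ultimately show ?thesis by blast
    qed
  qed
  then show ?thesis using that by (metis (mono_tags, lifting) mem_Collect_eq order_trans)
qed

text \<open>
  Shifting a minimal \<open>m\<close> in the direction \<open>y\<close> gives nothing smaller, so \<open>m x \<le> m (x + y) - m y\<close>.
\<close>

lemma minimal_sublinear_linear:
  assumes "sublinear m" and min: "\<And>q. sublinear q \<Longrightarrow> q \<le> m \<Longrightarrow> q = m"
  shows "linear m"
proof -
  have add: "m (x + y) = m x + m y" for x y
  proof -
    obtain q' where "sublinear q'" "q' \<le> m" "\<And>x. q' x \<le> m (x + y) - m y"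
      using sublinear_shift[OF assms(1)] by blast
    then have "m x \<le> m (x + y) - m y" using min by blast
    moreover have "m (x + y) \<le> m x + m y" using assms(1) by (simp add: sublinear_def)
    ultimately show ?thesis by simp
  qed
  have neg: "m (- x) = - m x" for x
    using add[of x "- x"] sublinear_zero[OF assms(1)] by simp
  have "m (t *\<^sub>R x) = t * m x" for t x
    using sublinear_scale[OF assms(1), of t x] sublinear_scale[OF assms(1), of "-t" x] neg[of "t *\<^sub>R x"]
    by (cases "t \<ge> 0") auto
  with add show ?thesis by (intro linearI) auto
qed

text \<open>A minimal functional below \<open>p\<close> is linear, but may be smaller than
  \<open>p\<close> at \<open>e\<close>. Shifting \<open>p\<close> in the direction \<open>e\<close>
  first forces \<open>h (- e) \<le> - p e\<close>, hence equality at \<open>e\<close>.\<close>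

lemma hahn_banach_sublinear:
  fixes p :: "'a::real_vector \<Rightarrow> real"
  assumes "sublinear p"
  obtains h where "linear h" "h \<le> p" "h e = p e"
proof -
  obtain p' where p': "sublinear p'" "p' \<le> p" "\<And>x. p' x \<le> p (x + e) - p e"
    using sublinear_shift[OF assms] by blast
  obtain h where h: "sublinear h" "h \<le> p'" "\<And>q. sublinear q \<Longrightarrow> q \<le> h \<Longrightarrow> q = h"
    using minimal_sublinear_exists[OF p'(1)] by blast
  have lin: "linear h" using minimal_sublinear_linear[OF h(1,3)] by blast
  have "h (- e) \<le> p 0 - p e" using h(2) p'(3)[of "- e"] by (auto simp: le_fun_def intro: order_trans)
  then have "p e \<le> h e"
    using sublinear_zero[OF assms] linear_neg[OF lin, of e] by simp
  moreover have "h \<le> p" using h(2) p'(2) by (rule order_trans)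
  ultimately show ?thesis using that[OF lin] by (metis antisym le_funD)
qed

section \<open>Functionals vanishing on a finite set\<close>

text \<open>A linear functional dominated by this distance vanishes on \<open>F\<close>, which makes
  it the right input for Hahn-Banach.\<close>

lemma sublinear_infdist_subspace:
  fixes F :: "'a::real_normed_vector set"
  assumes "subspace F"
  shows "sublinear (\<lambda>x. infdist x F)"
proof -
  have ne: "F \<noteq> {}" using assms subspace_0 by blast
  have "sublinear (\<lambda>x. INF a\<in>F. dist x a)"
  proof (rule sublinear_INF[OF ne])
    show "bdd_below ((\<lambda>a. dist x a) ` F)" for x by (rule bdd_belowI2[of _ 0]) simp
    show "\<exists>k\<in>F. dist (x + y) k \<le> dist x i + dist y j" if "i \<in> F" "j \<in> F" for i j x y
      using that assms by (intro bexI[of _ "i + j"]) (auto simp: subspace_add dist_triangle_add)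
    show "\<exists>k\<in>F. dist (t *\<^sub>R x) k \<le> t * dist x i" if "i \<in> F" "t > 0" for i t x
      using that assms
      by (intro bexI[of _ "t *\<^sub>R i"]) (auto simp: subspace_scale dist_norm simp flip: scaleR_diff_right)
    show "\<exists>k\<in>F. dist 0 k \<le> 0" using subspace_0[OF assms] by force
  qed
  then show ?thesis using ne by (simp add: infdist_notempty)
qed

text \<open>For a basis \<open>B\<close> of the span, \<open>insert e B\<close> is independent and
  \<open>e - y\<close> has coefficient 1 at \<open>e\<close>. The coefficient bound then keeps
  \<open>dist e y\<close> above \<open>1 / C\<close>.\<close>

lemma infdist_finite_span_pos:
  fixes X :: "'a::real_normed_vector set"
  assumes "finite X" "e \<notin> span X"
  shows "0 < infdist e (span X)"
proof -
  obtain B where B: "B \<subseteq> X" "independent B" "X \<subseteq> span B"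
    using maximal_independent_subset by blast
  have span: "span X = span B"
    using B by (metis span_mono span_span subset_antisym)
  have fin: "finite B" using B(1) assms(1) finite_subset by blast
  have e: "e \<notin> span B" "e \<notin> B" using assms(2) span span_base by auto
  then have "independent (insert e B)" using B(2) by (simp add: independent_insert)
  then obtain C where C: "C > 0"
    "\<And>c. (\<Sum>b\<in>insert e B. \<bar>c b\<bar>) \<le> C * norm (\<Sum>b\<in>insert e B. c b *\<^sub>R b)"
    using independent_coefficients_bound[of "insert e B"] fin by blast
  have "1 / C \<le> dist e y" if "y \<in> span B" for y
  proof -
    have "y \<in> range (\<lambda>c. \<Sum>b\<in>B. c b *\<^sub>R b)" using that span_finite[OF fin] by simp
    then obtain c where y: "y = (\<Sum>b\<in>B. c b *\<^sub>R b)" by (rule rangeE)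
    \<comment> \<open>These are the coefficients of \<open>e - y\<close> with respect to
      \<open>insert e B\<close>.\<close>
    define d where "d b = (if b = e then 1 else - c b)" for b
    have "(\<Sum>b\<in>insert e B. d b *\<^sub>R b) = e + (\<Sum>b\<in>B. d b *\<^sub>R b)"
      using fin e(2) by (simp add: d_def)
    also have "(\<Sum>b\<in>B. d b *\<^sub>R b) = - y"
      unfolding y using e(2) by (auto simp: d_def sum_negf[symmetric] intro!: sum.cong)
    finally have "(\<Sum>b\<in>insert e B. \<bar>d b\<bar>) \<le> C * dist e y"
      using C(2)[of d] by (simp add: dist_norm)
    moreover have "\<bar>d e\<bar> \<le> (\<Sum>b\<in>insert e B. \<bar>d b\<bar>)"
      using fin by (intro member_le_sum) auto
    ultimately have "1 \<le> C * dist e y" by (simp add: d_def)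
    then show ?thesis using C(1) by (simp add: field_simps)
  qed
  then have "1 / C \<le> infdist e (span B)"
    by (metis cINF_greatest infdist_notempty empty_iff span_zero)
  then show ?thesis using C(1) span by (smt (verit) divide_pos_pos)
qed

text \<open>Hahn-Banach below the distance to \<open>span X\<close>: the distance is at most the
  norm, is zero on \<open>X\<close> and is positive at \<open>e\<close>.\<close>

lemma separating_functional:
  fixes X :: "'a::real_normed_vector set"
  assumes "finite X" "e \<notin> span X"
  obtains \<eta> :: "'a \<Rightarrow>\<^sub>L real" where "\<And>x. x \<in> X \<Longrightarrow> blinfun_apply \<eta> x = 0" "blinfun_apply \<eta> e > 0"
proof -
  obtain h where h: "linear h" "h \<le> (\<lambda>x. infdist x (span X))" "h e = infdist e (span X)"
    using hahn_banach_sublinear[OF sublinear_infdist_subspace[OF subspace_span]] by blast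
  \<comment> \<open>The absolute value is \<open>h x\<close> or \<open>h (- x)\<close>. Both
    alternatives suffice below, since the norm and the span are invariant under negation.\<close>
  have le: "\<bar>h x\<bar> \<le> infdist x (span X) \<or> \<bar>h x\<bar> \<le> infdist (- x) (span X)" for x
    using h(2) linear_neg[OF h(1), of x] by (smt (verit) le_fun_def)
  have "infdist x (span X) \<le> norm x" for x
    using infdist_le[OF span_zero, of x X] by simp
  then have "\<bar>h x\<bar> \<le> norm x" for x
    using le[of x] by (metis norm_minus_cancel order_trans)
  then have bl: "bounded_linear h"
    by (intro bounded_linear_intro[of _ 1]) (auto simp: linear_add[OF h(1)] linear_cmul[OF h(1)])
  have "h x = 0" if "x \<in> X" for x
    using le[of x] span_base[OF that] span_neg[OF span_base[OF that]] by simp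
  moreover have "h e > 0" using infdist_finite_span_pos[OF assms] h(3) by simp
  ultimately show ?thesis
    using that[of "Blinfun h"] by (simp add: bounded_linear_Blinfun_apply[OF bl])
qed

section \<open>Free vector lattices and the free Banach lattice norm\<close>

lemma vector_sublattice_pos_homogeneous: "vector_sublattice pos_homogeneous pos_homogeneous"
  unfolding vector_sublattice_def
proof (intro conjI ballI allI)
  fix f g :: "('a \<Rightarrow>\<^sub>L real) \<Rightarrow> real" and c :: real
  assume f: "f \<in> pos_homogeneous"
  then show "(\<lambda>t. c * f t) \<in> pos_homogeneous" by (simp add: pos_homogeneous_def)
  assume g: "g \<in> pos_homogeneous"
  show "(\<lambda>t. f t + g t) \<in> pos_homogeneous"
    using f g by (simp add: pos_homogeneous_def distrib_left)
  show "sup f g \<in> pos_homogeneous"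
    using f g by (simp add: pos_homogeneous_def sup_max max_mult_distrib_left)
  show "inf f g \<in> pos_homogeneous"
    using f g by (simp add: pos_homogeneous_def inf_min min_mult_distrib_left)
qed (auto simp: pos_homogeneous_def)

lemma eval_at_pos_homogeneous: "eval_at x \<in> pos_homogeneous"
  by (simp add: pos_homogeneous_def eval_at_def blinfun.scaleR_left)

lemma FVL_apply: "(\<lambda>\<phi>. blinfun_apply \<phi> x) \<in> FVL"
  unfolding FVL_def eval_at_def by (rule hull_inc) simp

text \<open>The hull is an intersection of sublattices. The family is nonempty because
  \<open>pos_homogeneous\<close> belongs to it, so the intersection stays inside
  \<open>pos_homogeneous\<close>.\<close>

lemma vector_sublattice_FVL: "vector_sublattice FVL pos_homogeneous"
proof -
  have inter: "vector_sublattice (\<Inter>T) X"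
    if "X \<in> T" "\<And>Y. Y \<in> T \<Longrightarrow> vector_sublattice Y X" for T :: "('b \<Rightarrow> real) set set" and X
    using that unfolding vector_sublattice_def by auto
  have "pos_homogeneous \<in> {Y. vector_sublattice Y pos_homogeneous \<and> range eval_at \<subseteq> Y}"
    using vector_sublattice_pos_homogeneous eval_at_pos_homogeneous by auto
  then show ?thesis unfolding FVL_def hull_def
    by (intro inter) auto
qed

lemma FVL_pos_homogeneous: "f \<in> FVL \<Longrightarrow> f \<in> pos_homogeneous"
  using vector_sublattice_FVL unfolding vector_sublattice_def by blast

lemma FVL_zero: "(\<lambda>_. 0) \<in> FVL"
  and FVL_add: "f \<in> FVL \<Longrightarrow> g \<in> FVL \<Longrightarrow> (\<lambda>t. f t + g t) \<in> FVL"
  and FVL_scale: "f \<in> FVL \<Longrightarrow> (\<lambda>t. c * f t) \<in> FVL"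
  and FVL_sup: "f \<in> FVL \<Longrightarrow> g \<in> FVL \<Longrightarrow> sup f g \<in> FVL"
  using vector_sublattice_FVL unfolding vector_sublattice_def by blast+

lemma FVL_diff: "f \<in> FVL \<Longrightarrow> g \<in> FVL \<Longrightarrow> (\<lambda>t. f t - g t) \<in> FVL"
  using FVL_add[of f "\<lambda>t. - 1 * g t"] FVL_scale[of g "-1"] by simp

lemma FVL_pos_part: "f \<in> FVL \<Longrightarrow> (\<lambda>t. max 0 (f t)) \<in> FVL"
  using FVL_sup[OF FVL_zero, of f] by (simp add: sup_fun_def sup_max)

lemma FVL_abs: "f \<in> FVL \<Longrightarrow> (\<lambda>t. \<bar>f t\<bar>) \<in> FVL"
proof -
  assume f: "f \<in> FVL"
  have "(\<lambda>t. \<bar>f t\<bar>) = sup f (\<lambda>t. - 1 * f t)"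
    by (auto simp: sup_fun_def sup_max)
  then show ?thesis using FVL_sup[OF f FVL_scale[OF f]] by metis
qed

lemma FVL_sum: "(\<And>i. i \<in> I \<Longrightarrow> f i \<in> FVL) \<Longrightarrow> (\<lambda>t. \<Sum>i\<in>I. f i t) \<in> FVL"
  by (induction I rule: infinite_finite_induct) (auto intro: FVL_zero FVL_add)

text \<open>The positively homogeneous functions with property \<open>P\<close> form a sublattice
  containing the evaluations, hence contain the hull. The zero function is 0 times an
  evaluation.\<close>

lemma FVL_induct [consumes 1, case_names eval add scale sup inf]:
  assumes "f \<in> FVL"
    and eval: "\<And>x. P (eval_at x)"
    and add: "\<And>f g. P f \<Longrightarrow> P g \<Longrightarrow> P (\<lambda>t. f t + g t)"
    and scale: "\<And>c f. P f \<Longrightarrow> P (\<lambda>t. c * f t)"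
    and sup: "\<And>f g. P f \<Longrightarrow> P g \<Longrightarrow> P (sup f g)"
    and inf: "\<And>f g. P f \<Longrightarrow> P g \<Longrightarrow> P (inf f g)"
  shows "P f"
proof -
  have "P (\<lambda>_. 0)" using scale[OF eval, of 0] by simp
  then have "vector_sublattice {f \<in> pos_homogeneous. P f} pos_homogeneous"
    using vector_sublattice_pos_homogeneous assms(2-)
    unfolding vector_sublattice_def by (simp add: conj_commute) blast
  moreover have "range eval_at \<subseteq> {f \<in> pos_homogeneous. P f}"
    using eval eval_at_pos_homogeneous by auto
  ultimately have "FVL \<subseteq> {f \<in> pos_homogeneous. P f}"
    unfolding FVL_def by (intro hull_minimal)
  then show ?thesis using assms(1) by auto
qed

lemma FVL_continuous: "f \<in> FVL \<Longrightarrow> continuous_on S f"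
proof (induction rule: FVL_induct)
  case (eval x)
  show ?case unfolding eval_at_def by (intro continuous_intros)
next
  case (sup f g)
  then show ?case by (simp add: sup_fun_def sup_max continuous_on_max)
next
  case (inf f g)
  then show ?case by (simp add: inf_fun_def inf_min continuous_on_min)
qed (intro continuous_intros; assumption)+

text \<open>An element is built from evaluations in finitely many steps; a binary operation takes
  the union of the two finite sets.\<close>

lemma FVL_finitely_determined:
  assumes "f \<in> FVL"
  obtains X where "finite X"
    "\<And>\<phi> \<psi>. (\<And>x. x \<in> X \<Longrightarrow> blinfun_apply \<phi> x = blinfun_apply \<psi> x) \<Longrightarrow> f \<phi> = f \<psi>"
proof -
  let ?P = "\<lambda>f X. finite X \<and>
    (\<forall>\<phi> \<psi>. (\<forall>x\<in>X. blinfun_apply \<phi> x = blinfun_apply \<psi> x) \<longrightarrow> f \<phi> = f \<psi>)"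
  have comb: "\<exists>X. ?P h X" if "\<exists>X. ?P f X" "\<exists>X. ?P g X"
    and "\<And>\<phi> \<psi>. f \<phi> = f \<psi> \<Longrightarrow> g \<phi> = g \<psi> \<Longrightarrow> h \<phi> = h \<psi>" for f g h
  proof -
    obtain X Y where "?P f X" "?P g Y" using \<open>\<exists>X. ?P f X\<close> \<open>\<exists>X. ?P g X\<close> by blast
    then have "?P h (X \<union> Y)" using that(3) by (metis UnCI finite_Un)
    then show ?thesis by blast
  qed
  have "\<exists>X. ?P f X"
    using assms
  proof (induction rule: FVL_induct)
    case (eval x)
    then show ?case by (intro exI[of _ "{x}"]) (simp add: eval_at_def)
  next
    case (add f g)
    then show ?case by (rule comb) simp
  next
    case (scale c f)
    then show ?case by metis
  next
    case (sup f g)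
    then show ?case by (rule comb) simp
  next
    case (inf f g)
    then show ?case by (rule comb) simp
  qed
  then show ?thesis using that by metis
qed

section \<open>Norm estimates and membership in \<open>FBL p\<close>\<close>

lemma enn2real_ge_1: "1 \<le> p \<Longrightarrow> p \<noteq> \<infinity> \<Longrightarrow> 1 \<le> enn2real p"
  by (metis enn2real_1 enn2real_mono ennreal_1 infinity_ennreal_def less_top)

text \<open>Monotonicity of powers removes the outer root and turns the supremum into a bound on
  every sum of powers, the form used in all later estimates.\<close>

lemma FBL_norm_le_iff:
  assumes "1 \<le> p" "0 \<le> C"
  shows "FBL_norm p f \<le> ennreal C \<longleftrightarrow>
    (if p = \<infinity> then \<forall>\<phi>\<in>cball 0 1. \<bar>f \<phi>\<bar> \<le> C
     else \<forall>\<phi>s\<in>weakly_p_bounded (enn2real p).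
       (\<Sum>\<phi>\<leftarrow>\<phi>s. \<bar>f \<phi>\<bar> powr enn2real p) \<le> C powr enn2real p)"
proof (cases "p = \<infinity>")
  case True
  then show ?thesis using assms by (simp add: FBL_norm_def SUP_le_iff)
next
  case False
  let ?q = "enn2real p"
  have q: "?q \<ge> 1" using enn2real_ge_1 assms(1) False by blast
  have "S powr (1 / ?q) \<le> C \<longleftrightarrow> S \<le> C powr ?q" if "S \<ge> 0" for S
  proof
    assume "S powr (1 / ?q) \<le> C"
    then have "(S powr (1 / ?q)) powr ?q \<le> C powr ?q" using q by (intro powr_mono2) auto
    then show "S \<le> C powr ?q" using q that by (simp add: powr_powr)
  next
    assume "S \<le> C powr ?q"
    then have "S powr (1 / ?q) \<le> (C powr ?q) powr (1 / ?q)" using q that by (intro powr_mono2) auto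
    then show "S powr (1 / ?q) \<le> C" using q assms(2) by (simp add: powr_powr)
  qed
  moreover have "(\<Sum>\<phi>\<leftarrow>\<phi>s. \<bar>f \<phi>\<bar> powr ?q) \<ge> 0" for \<phi>s
    by (intro sum_list_nonneg) auto
  ultimately show ?thesis using False assms(2) by (simp add: FBL_norm_def SUP_le_iff)
qed

text \<open>The one-term sequence \<open>[\<phi>]\<close> is admissible. Convergence in the norm is
  therefore uniform on the dual ball.\<close>

lemma abs_le_FBL_norm:
  assumes "1 \<le> p" "norm \<phi> \<le> 1"
  shows "ennreal \<bar>f \<phi>\<bar> \<le> FBL_norm p f"
proof (cases "p = \<infinity>")
  case True
  then show ?thesis using assms(2) by (auto simp: FBL_norm_def intro!: SUP_upper)
next
  case False
  let ?q = "enn2real p"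
  have q: "?q \<ge> 1" using enn2real_ge_1 assms(1) False by blast
  have "\<bar>blinfun_apply \<phi> x\<bar> powr ?q \<le> 1" if "norm x \<le> 1" for x
  proof -
    have "\<bar>blinfun_apply \<phi> x\<bar> \<le> norm \<phi> * norm x" using norm_blinfun[of \<phi> x] by simp
    also have "\<dots> \<le> 1" using assms(2) that by (simp add: mult_le_one)
    finally show ?thesis using q by (intro powr_le1) auto
  qed
  then have "[\<phi>] \<in> weakly_p_bounded ?q" by (simp add: weakly_p_bounded_def)
  moreover have "\<bar>f \<phi>\<bar> = (\<Sum>\<psi>\<leftarrow>[\<phi>]. \<bar>f \<psi>\<bar> powr ?q) powr (1 / ?q)"
    using q by (simp add: powr_powr)
  ultimately show ?thesis
    using False by (auto simp: FBL_norm_def intro!: SUP_upper2)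
qed

text \<open>The constant 4 is not optimal: it replaces Minkowski's inequality by \<open>u + v \<le> 2 max u v\<close>.\<close>

lemma FBL_norm_add_le:
  assumes "1 \<le> p" "0 \<le> a" "0 \<le> b" "FBL_norm p f \<le> ennreal a" "FBL_norm p g \<le> ennreal b"
    and h: "\<And>\<phi>. \<bar>h \<phi>\<bar> \<le> \<bar>f \<phi>\<bar> + \<bar>g \<phi>\<bar>"
  shows "FBL_norm p h \<le> ennreal (4 * (a + b))"
proof (cases "p = \<infinity>")
  case True
  then have "\<bar>h \<phi>\<bar> \<le> 4 * (a + b)" if "\<phi> \<in> cball 0 1" for \<phi>
  proof -
    have "\<bar>f \<phi>\<bar> \<le> a" "\<bar>g \<phi>\<bar> \<le> b"
      using True assms(4,5) that FBL_norm_le_iff[OF assms(1,2), of f]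
        FBL_norm_le_iff[OF assms(1,3), of g] by auto
    then have "\<bar>h \<phi>\<bar> \<le> a + b" using h[of \<phi>] by (meson add_mono order_trans)
    then show ?thesis using assms(2,3) by simp
  qed
  then show ?thesis
    using True assms by (subst FBL_norm_le_iff) auto
next
  case False
  let ?q = "enn2real p"
  have q: "?q \<ge> 1" using enn2real_ge_1 assms(1) False by blast
  have pt: "\<bar>h \<phi>\<bar> powr ?q \<le> 2 powr ?q * (\<bar>f \<phi>\<bar> powr ?q + \<bar>g \<phi>\<bar> powr ?q)" for \<phi>
  proof -
    have "\<bar>h \<phi>\<bar> powr ?q \<le> (2 * max \<bar>f \<phi>\<bar> \<bar>g \<phi>\<bar>) powr ?q"
      using q h[of \<phi>] by (intro powr_mono2) auto
    also have "\<dots> = 2 powr ?q * (max \<bar>f \<phi>\<bar> \<bar>g \<phi>\<bar>) powr ?q"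
      by (simp add: powr_mult)
    also have "(max \<bar>f \<phi>\<bar> \<bar>g \<phi>\<bar>) powr ?q \<le> \<bar>f \<phi>\<bar> powr ?q + \<bar>g \<phi>\<bar> powr ?q"
      by (simp add: max_def)
    finally show ?thesis by simp
  qed
  have "(\<Sum>\<phi>\<leftarrow>\<phi>s. \<bar>h \<phi>\<bar> powr ?q) \<le> (4 * (a + b)) powr ?q"
    if W: "\<phi>s \<in> weakly_p_bounded ?q" for \<phi>s
  proof -
    have "(\<Sum>\<phi>\<leftarrow>\<phi>s. \<bar>h \<phi>\<bar> powr ?q) \<le> (\<Sum>\<phi>\<leftarrow>\<phi>s. 2 powr ?q * (\<bar>f \<phi>\<bar> powr ?q + \<bar>g \<phi>\<bar> powr ?q))"
      using pt by (intro sum_list_mono) auto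
    also have "\<dots> = 2 powr ?q * ((\<Sum>\<phi>\<leftarrow>\<phi>s. \<bar>f \<phi>\<bar> powr ?q) + (\<Sum>\<phi>\<leftarrow>\<phi>s. \<bar>g \<phi>\<bar> powr ?q))"
      by (simp add: sum_list_const_mult sum_list_addf)
    also have "\<dots> \<le> 2 powr ?q * (a powr ?q + b powr ?q)"
      using assms(2-5) W False FBL_norm_le_iff[OF assms(1,2), of f] FBL_norm_le_iff[OF assms(1,3), of g]
      by (intro mult_left_mono add_mono) auto
    also have "\<dots> \<le> 2 powr ?q * (2 * (a + b) powr ?q)"
    proof -
      have "a powr ?q \<le> (a + b) powr ?q" "b powr ?q \<le> (a + b) powr ?q"
        using q assms(2,3) by (auto intro!: powr_mono2)
      then show ?thesis by simp
    qed
    \<comment> \<open>As \<open>?q \<ge> 1\<close>, the remaining factor 2 is at most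
      \<open>2 powr ?q\<close>; the two such powers combine to \<open>4 powr ?q\<close>.\<close>
    also have "\<dots> \<le> 2 powr ?q * (2 powr ?q * (a + b) powr ?q)"
      using powr_mono[OF q, of 2] by (intro mult_left_mono mult_right_mono) auto
    also have "\<dots> = (4 * (a + b)) powr ?q"
      using assms(2,3) by (simp flip: powr_mult)
    finally show ?thesis .
  qed
  then show ?thesis using False assms by (subst FBL_norm_le_iff) auto
qed

lemma FBL_norm_scale_le:
  assumes "1 \<le> p" "0 \<le> a" "FBL_norm p f \<le> ennreal a"
  shows "FBL_norm p (\<lambda>\<phi>. c * f \<phi>) \<le> ennreal (\<bar>c\<bar> * a)"
proof (cases "p = \<infinity>")
  case True
  then show ?thesis using assms FBL_norm_le_iff[OF assms(1,2), of f]
    by (subst FBL_norm_le_iff) (auto simp: abs_mult intro!: mult_left_mono)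
next
  case False
  then show ?thesis using assms FBL_norm_le_iff[OF assms(1,2), of f]
    by (subst FBL_norm_le_iff)
      (auto simp: abs_mult powr_mult sum_list_const_mult intro!: mult_left_mono)
qed

text \<open>For finite \<open>p\<close> and nonzero \<open>x\<close>, the admissibility condition is
  applied to the unit vector \<open>x /\<^sub>R norm x\<close> and rescaled.\<close>

lemma FBL_norm_eval_at_le:
  assumes "1 \<le> p"
  shows "FBL_norm p (eval_at x) \<le> ennreal (norm x)"
proof (cases "p = \<infinity>")
  case True
  have "\<bar>blinfun_apply \<phi> x\<bar> \<le> norm x" if "norm \<phi> \<le> 1" for \<phi>
    using norm_blinfun[of \<phi> x] mult_right_mono[OF that, of "norm x"] by simp
  then show ?thesis using True assms by (subst FBL_norm_le_iff) (auto simp: eval_at_def)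
next
  case False
  let ?q = "enn2real p"
  have "(\<Sum>\<phi>\<leftarrow>\<phi>s. \<bar>blinfun_apply \<phi> x\<bar> powr ?q) \<le> norm x powr ?q"
    if W: "\<phi>s \<in> weakly_p_bounded ?q" for \<phi>s
  proof (cases "x = 0")
    case True
    then show ?thesis by (simp add: blinfun.zero_right)
  next
    case False
    have "\<bar>blinfun_apply \<phi> x\<bar> powr ?q = norm x powr ?q * \<bar>blinfun_apply \<phi> (x /\<^sub>R norm x)\<bar> powr ?q" for \<phi>
      using False by (simp add: blinfun.scaleR_right abs_mult flip: powr_mult mult.assoc)
    then have "(\<Sum>\<phi>\<leftarrow>\<phi>s. \<bar>blinfun_apply \<phi> x\<bar> powr ?q)
        = norm x powr ?q * (\<Sum>\<phi>\<leftarrow>\<phi>s. \<bar>blinfun_apply \<phi> (x /\<^sub>R norm x)\<bar> powr ?q)"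
      by (simp add: sum_list_const_mult)
    also have "\<dots> \<le> norm x powr ?q * 1"
      using W False unfolding weakly_p_bounded_def by (intro mult_left_mono) auto
    finally show ?thesis by simp
  qed
  then show ?thesis using False assms by (subst FBL_norm_le_iff) (auto simp: eval_at_def)
qed

text \<open>Sum, supremum and infimum of \<open>f\<close> and \<open>g\<close> are all dominated by
  \<open>\<bar>f\<bar> + \<bar>g\<bar>\<close>, so \<open>FBL_norm_add_le\<close> serves all
  three.\<close>

lemma FVL_norm_bounded:
  assumes "1 \<le> p" "f \<in> FVL"
  shows "\<exists>C\<ge>0. FBL_norm p f \<le> ennreal C"
  using assms(2)
proof (induction rule: FVL_induct)
  case (eval x)
  then show ?case using FBL_norm_eval_at_le[OF assms(1)] norm_ge_zero by blast
next
  case (add f g)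
  then obtain a b where "a \<ge> 0" "b \<ge> 0" "FBL_norm p f \<le> ennreal a" "FBL_norm p g \<le> ennreal b"
    by blast
  then show ?case
    by (intro exI[of _ "4 * (a + b)"] conjI FBL_norm_add_le[OF assms(1), of a b f g]) auto
next
  case (scale c f)
  then obtain a where "a \<ge> 0" "FBL_norm p f \<le> ennreal a" by blast
  then show ?case
    by (intro exI[of _ "\<bar>c\<bar> * a"] conjI FBL_norm_scale_le[OF assms(1)]) auto
next
  case (sup f g)
  then obtain a b where "a \<ge> 0" "b \<ge> 0" "FBL_norm p f \<le> ennreal a" "FBL_norm p g \<le> ennreal b"
    by blast
  then show ?case
    by (intro exI[of _ "4 * (a + b)"] conjI FBL_norm_add_le[OF assms(1), of a b f g])
      (auto simp: sup_max max_def)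
next
  case (inf f g)
  then obtain a b where "a \<ge> 0" "b \<ge> 0" "FBL_norm p f \<le> ennreal a" "FBL_norm p g \<le> ennreal b"
    by blast
  then show ?case
    by (intro exI[of _ "4 * (a + b)"] conjI FBL_norm_add_le[OF assms(1), of a b f g])
      (auto simp: inf_min min_def)
qed

lemma FBL_norm_zero: "FBL_norm p (\<lambda>_. 0) = 0"
  using zero_le by (auto simp: FBL_norm_def SUP_eq_iff bot_ennreal intro!: antisym SUP_least)

lemma FVL_subset_FBL: "1 \<le> p \<Longrightarrow> FVL \<subseteq> FBL p"
proof
  fix f :: "('a \<Rightarrow>\<^sub>L real) \<Rightarrow> real"
  assume p: "1 \<le> p" and f: "f \<in> FVL"
  have "FBL_norm p f < \<infinity>"
    using FVL_norm_bounded[OF p f] by (auto simp: less_top[symmetric] top_unique)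
  moreover have "FBL_norm p (\<lambda>\<phi>. f \<phi> - f \<phi>) = 0" using FBL_norm_zero by simp
  ultimately show "f \<in> FBL p"
    using f FVL_pos_homogeneous unfolding FBL_def Hp_def by force
qed

text \<open>A uniform limit of continuous functions on the dual ball is continuous there, and norm
  approximation by elements of \<open>FVL\<close> is uniform on that ball.\<close>

lemma FBL_continuous:
  assumes "1 \<le> p" "f \<in> FBL p"
  shows "continuous_on (cball 0 1) f"
  unfolding continuous_on_iff
proof (intro ballI allI impI)
  fix \<phi> :: "'a \<Rightarrow>\<^sub>L real" and \<epsilon> :: real
  assume \<phi>: "\<phi> \<in> cball 0 1" and "\<epsilon> > 0"
  then have "ennreal (\<epsilon> / 3) > 0" by simp
  then obtain g where g: "g \<in> FVL" "FBL_norm p (\<lambda>\<phi>. f \<phi> - g \<phi>) < ennreal (\<epsilon> / 3)"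
    using assms(2) unfolding FBL_def by blast
  have close: "\<bar>f \<psi> - g \<psi>\<bar> < \<epsilon> / 3" if "\<psi> \<in> cball 0 1" for \<psi>
  proof -
    have "ennreal \<bar>f \<psi> - g \<psi>\<bar> < ennreal (\<epsilon> / 3)"
      using abs_le_FBL_norm[OF assms(1), of \<psi> "\<lambda>\<phi>. f \<phi> - g \<phi>"] that g(2) by simp
    then show ?thesis using \<open>\<epsilon> > 0\<close> by (simp add: ennreal_less_iff)
  qed
  obtain d where d: "d > 0" "\<And>\<psi>. dist \<psi> \<phi> < d \<Longrightarrow> dist (g \<psi>) (g \<phi>) < \<epsilon> / 3"
    using FVL_continuous[OF g(1), of UNIV] \<open>\<epsilon> > 0\<close> unfolding continuous_on_iff
    by (metis UNIV_I divide_pos_pos zero_less_numeral)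
  have "dist (f \<psi>) (f \<phi>) < \<epsilon>" if "\<psi> \<in> cball 0 1" "dist \<psi> \<phi> < d" for \<psi>
    using close[OF \<phi>] close[OF that(1)] d(2)[OF that(2)] unfolding dist_real_def by linarith
  then show "\<exists>d>0. \<forall>\<psi>\<in>cball 0 1. dist \<psi> \<phi> < d \<longrightarrow> dist (f \<psi>) (f \<phi>) < \<epsilon>"
    using d(1) by blast
qed

text \<open>
  The case \<open>p < \<infinity>\<close> avoids Jensen's inequality: if \<open>S = \<Sum>n. 2\<^sup>-\<^sup>n\<^sup>-\<^sup>1 u\<^sub>n\<^sup>p\<close>, then
  \<open>u\<^sub>n \<le> 2\<^sup>n\<^sup>+\<^sup>1 S\<^sup>1\<^sup>/\<^sup>p\<close>, and the weights \<open>4\<^sup>-\<^sup>n\<^sup>-\<^sup>1\<close> absorb the factor \<open>2\<^sup>n\<^sup>+\<^sup>1\<close>.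
\<close>

lemma FBL_norm_series_le:
  fixes h :: "('a::banach \<Rightarrow>\<^sub>L real) \<Rightarrow> real"
  assumes "1 \<le> p" "0 \<le> c" and e: "\<And>n. norm (e n) \<le> 1"
    and h: "\<And>\<phi>. \<bar>h \<phi>\<bar> \<le> c * (\<Sum>n. (1/4)^Suc n * \<bar>blinfun_apply \<phi> (e n)\<bar>)"
  shows "FBL_norm p h \<le> ennreal c"
proof (cases "p = \<infinity>")
  case True
  have "(\<Sum>n. (1/4)^Suc n * \<bar>blinfun_apply \<phi> (e n)\<bar>) \<le> 1"
    if "norm \<phi> \<le> 1" for \<phi> :: "'a \<Rightarrow>\<^sub>L real"
  proof -
    have le: "\<bar>blinfun_apply \<phi> (e n)\<bar> \<le> 1" for n
    proof -
      have "\<bar>blinfun_apply \<phi> (e n)\<bar> \<le> norm \<phi> * norm (e n)" using norm_blinfun[of \<phi> "e n"] by simp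
      also have "\<dots> \<le> 1" using that e by (simp add: mult_le_one)
      finally show ?thesis .
    qed
    have s: "(\<lambda>n. (1/4::real)^Suc n) sums (1/3)"
      using sums_mult[OF geometric_sums[of "1/4::real"], of "1/4"] by simp
    have "(\<Sum>n. (1/4)^Suc n * \<bar>blinfun_apply \<phi> (e n)\<bar>) \<le> (\<Sum>n. (1/4::real)^Suc n)"
      using le sums_summable[OF s]
      by (intro suminf_le summable_comparison_test'[OF sums_summable[OF s], of 0]) (auto simp: mult_le_cancel_left1)
    then show ?thesis using sums_unique[OF s] by simp
  qed
  then have "\<bar>h \<phi>\<bar> \<le> c" if "norm \<phi> \<le> 1" for \<phi>
    using order_trans[OF h[of \<phi>] mult_left_mono[OF _ assms(2)]] that by force
  then show ?thesis using True assms by (subst FBL_norm_le_iff) auto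
next
  case False
  let ?q = "enn2real p"
  have q: "?q \<ge> 1" using enn2real_ge_1 assms(1) False by blast
  have half: "(\<lambda>n. (1/2::real)^Suc n) sums 1" by (rule power_half_series)
  define s where "s \<phi> n = (1/2)^Suc n * \<bar>blinfun_apply \<phi> (e n)\<bar> powr ?q"
    for \<phi> :: "'a \<Rightarrow>\<^sub>L real" and n
  have summable_s: "summable (s \<phi>)" for \<phi>
  proof (rule summable_comparison_test')
    show "summable (\<lambda>n. (1/2)^Suc n * norm \<phi> powr ?q)"
      using sums_summable[OF half] by (rule summable_mult2)
    fix n :: nat
    have "\<bar>blinfun_apply \<phi> (e n)\<bar> \<le> norm \<phi>"
      using norm_blinfun[of \<phi> "e n"] mult_left_mono[OF e[of n], of "norm \<phi>"] by simp
    then have "\<bar>blinfun_apply \<phi> (e n)\<bar> powr ?q \<le> norm \<phi> powr ?q"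
      using q by (intro powr_mono2) auto
    then show "norm (s \<phi> n) \<le> (1/2)^Suc n * norm \<phi> powr ?q"
      by (simp add: s_def)
  qed
  have s_nonneg: "s \<phi> n \<ge> 0" for \<phi> n by (simp add: s_def)
  have pt: "\<bar>h \<phi>\<bar> powr ?q \<le> c powr ?q * suminf (s \<phi>)" for \<phi>
  proof -
    let ?S = "suminf (s \<phi>)"
    have S: "?S \<ge> 0" using suminf_nonneg[OF summable_s] s_nonneg by blast
    have le: "(1/4)^Suc n * \<bar>blinfun_apply \<phi> (e n)\<bar> \<le> (1/2)^Suc n * ?S powr (1 / ?q)" for n
    proof -
      \<comment> \<open>A single term of a nonnegative series is at most its sum.\<close>
      have "s \<phi> n \<le> ?S"
        using sum_le_suminf[OF summable_s, of "{n}"] s_nonneg by simp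
      then have "\<bar>blinfun_apply \<phi> (e n)\<bar> powr ?q \<le> 2^Suc n * ?S"
        by (simp add: s_def field_simps)
      then have "(\<bar>blinfun_apply \<phi> (e n)\<bar> powr ?q) powr (1 / ?q) \<le> (2^Suc n * ?S) powr (1 / ?q)"
        using q by (intro powr_mono2) auto
      then have "\<bar>blinfun_apply \<phi> (e n)\<bar> \<le> (2^Suc n * ?S) powr (1 / ?q)"
        using q by (simp add: powr_powr)
      also have "\<dots> = (2^Suc n) powr (1 / ?q) * ?S powr (1 / ?q)"
        using S by (simp add: powr_mult)
      also have "\<dots> \<le> 2^Suc n * ?S powr (1 / ?q)"
      proof -
        \<comment> \<open>The base is at least 1 and the exponent \<open>1 / ?q\<close> at most
          1.\<close>
        have "(2^Suc n :: real) powr (1 / ?q) \<le> (2^Suc n) powr 1"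
          using q one_le_power[of "2::real" "Suc n"] by (intro powr_mono) auto
        then show ?thesis by (intro mult_right_mono) auto
      qed
      finally have "(1/4)^Suc n * \<bar>blinfun_apply \<phi> (e n)\<bar> \<le> (1/4)^Suc n * (2^Suc n * ?S powr (1 / ?q))"
        by (intro mult_left_mono) auto
      also have "\<dots> = (1/4 * 2)^Suc n * ?S powr (1 / ?q)"
        by (simp only: power_mult_distrib mult.assoc)
      finally show ?thesis by simp
    qed
    have sums: "(\<lambda>n. (1/2)^Suc n * ?S powr (1 / ?q)) sums (?S powr (1 / ?q))"
      using sums_mult2[OF half] by simp
    have "(\<Sum>n. (1/4)^Suc n * \<bar>blinfun_apply \<phi> (e n)\<bar>) \<le> (\<Sum>n. (1/2)^Suc n * ?S powr (1 / ?q))"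
      using le sums_summable[OF sums]
      by (intro suminf_le summable_comparison_test'[OF sums_summable[OF sums], of 0]) auto
    also have "\<dots> = ?S powr (1 / ?q)" using sums_unique[OF sums] by simp
    finally have "\<bar>h \<phi>\<bar> \<le> c * ?S powr (1 / ?q)"
      by (rule order_trans[OF h[of \<phi>] mult_left_mono[OF _ assms(2)]])
    then have "\<bar>h \<phi>\<bar> powr ?q \<le> (c * ?S powr (1 / ?q)) powr ?q"
      using q by (intro powr_mono2) auto
    then show ?thesis using q S assms(2) by (simp add: powr_mult powr_powr)
  qed
  have "(\<Sum>\<phi>\<leftarrow>\<phi>s. \<bar>h \<phi>\<bar> powr ?q) \<le> c powr ?q" if W: "\<phi>s \<in> weakly_p_bounded ?q" for \<phi>s
  proof -
    \<comment> \<open>The finite sum over the list is interchanged with the series. Admissibility at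
      each \<open>e n\<close> then bounds the inner sums by 1, and the weights add up to 1.\<close>
    have swap: "(\<lambda>n. \<Sum>\<phi>\<leftarrow>\<phi>s. s \<phi> n) sums (\<Sum>\<phi>\<leftarrow>\<phi>s. suminf (s \<phi>))"
      by (induction \<phi>s) (auto intro!: sums_add summable_sums summable_s)
    have "(\<Sum>\<phi>\<leftarrow>\<phi>s. s \<phi> n) \<le> (1/2)^Suc n" for n
    proof -
      have "(\<Sum>\<phi>\<leftarrow>\<phi>s. s \<phi> n) = (1/2)^Suc n * (\<Sum>\<phi>\<leftarrow>\<phi>s. \<bar>blinfun_apply \<phi> (e n)\<bar> powr ?q)"
        by (simp only: s_def sum_list_const_mult)
      also have "\<dots> \<le> (1/2)^Suc n * 1"
        using W e[of n] unfolding weakly_p_bounded_def by (intro mult_left_mono) auto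
      finally show ?thesis by simp
    qed
    then have S: "(\<Sum>\<phi>\<leftarrow>\<phi>s. suminf (s \<phi>)) \<le> 1" by (rule sums_le[OF _ swap half])
    have "(\<Sum>\<phi>\<leftarrow>\<phi>s. \<bar>h \<phi>\<bar> powr ?q) \<le> (\<Sum>\<phi>\<leftarrow>\<phi>s. c powr ?q * suminf (s \<phi>))"
      using pt by (intro sum_list_mono) auto
    also have "\<dots> = c powr ?q * (\<Sum>\<phi>\<leftarrow>\<phi>s. suminf (s \<phi>))"
      by (simp add: sum_list_const_mult)
    also have "\<dots> \<le> c powr ?q" using S by (simp add: mult_left_le)
    finally show ?thesis .
  qed
  then show ?thesis using False assms by (subst FBL_norm_le_iff) auto
qed

section \<open>Order density\<close>

text \<open>Coordinates of \<open>x\<close> have l1-sum at most \<open>C * norm x\<close>, so the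
  values of a functional on the basis control its norm.\<close>

lemma dual_norm_le_basis_sum:
  fixes B :: "'a::real_normed_vector set"
  assumes "finite B" "independent B" "span B = UNIV"
  obtains C where "C > 0" "\<And>\<phi> :: 'a \<Rightarrow>\<^sub>L real. norm \<phi> \<le> C * (\<Sum>b\<in>B. \<bar>blinfun_apply \<phi> b\<bar>)"
proof -
  obtain C where C: "C > 0" "\<And>c. (\<Sum>b\<in>B. \<bar>c b\<bar>) \<le> C * norm (\<Sum>b\<in>B. c b *\<^sub>R b)"
    using independent_coefficients_bound[OF assms(1,2)] by blast
  have "norm \<phi> \<le> C * (\<Sum>b\<in>B. \<bar>blinfun_apply \<phi> b\<bar>)" for \<phi> :: "'a \<Rightarrow>\<^sub>L real"
  proof (rule norm_blinfun_bound)
    let ?S = "\<Sum>b\<in>B. \<bar>blinfun_apply \<phi> b\<bar>"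
    show "0 \<le> C * ?S" using C(1) by (simp add: sum_nonneg)
    fix x
    have "x \<in> range (\<lambda>c. \<Sum>b\<in>B. c b *\<^sub>R b)" using assms(3) span_finite[OF assms(1)] by simp
    then obtain c where x: "x = (\<Sum>b\<in>B. c b *\<^sub>R b)" by (rule rangeE)
    have "norm (blinfun_apply \<phi> x) \<le> (\<Sum>b\<in>B. \<bar>c b\<bar> * \<bar>blinfun_apply \<phi> b\<bar>)"
      unfolding x by (simp add: blinfun.sum_right blinfun.scaleR_right flip: abs_mult)
    also have "\<dots> \<le> (\<Sum>b\<in>B. \<bar>c b\<bar> * ?S)"
      using assms(1) by (intro sum_mono mult_left_mono member_le_sum) auto
    also have "\<dots> = (\<Sum>b\<in>B. \<bar>c b\<bar>) * ?S" by (simp add: sum_distrib_right)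
    also have "\<dots> \<le> (C * norm x) * ?S"
      using C(2)[of c] unfolding x by (intro mult_right_mono) (auto simp: sum_nonneg)
    finally show "norm (blinfun_apply \<phi> x) \<le> C * ?S * norm x" by (simp add: mult_ac)
  qed
  then show ?thesis using that C(1) by blast
qed

text \<open>Where \<open>g \<phi> > 0\<close>, the number \<open>t = \<phi> x0\<close> is positive
  and \<open>\<phi> / t\<close> lies within \<open>r\<close> of \<open>\<phi>0\<close>. Homogeneity
  then gives \<open>f \<phi> > \<epsilon> * t \<ge> g \<phi>\<close>; elsewhere \<open>g\<close> is
  0.\<close>

lemma FBL_minorant_finite_dimensional:
  fixes f :: "('a::banach \<Rightarrow>\<^sub>L real) \<Rightarrow> real" and X :: "'a set"
  assumes p: "1 \<le> p" and X: "finite X" "span X = UNIV"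
    and f: "f \<in> FBL p" "(\<lambda>_. 0) < f"
  shows "\<exists>g\<in>FVL. (\<lambda>_. 0) < g \<and> g \<le> f"
proof -
  have hom: "f (c *\<^sub>R \<phi>) = c * f \<phi>" if "c \<ge> 0" for c \<phi>
    using f(1) that by (simp add: FBL_def Hp_def pos_homogeneous_def)
  have nonneg: "f \<phi> \<ge> 0" for \<phi> using f(2) by (simp add: less_fun_def le_fun_def)
  obtain \<phi>1 where \<phi>1: "f \<phi>1 > 0" using f(2) nonneg by (auto simp: less_fun_def le_fun_def not_le)
  have "\<phi>1 \<noteq> 0" using hom[of 0 0] \<phi>1 by auto
  \<comment> \<open>Norm \<open>1 / 2\<close> leaves room for a ball of radius \<open>1 / 2\<close>
    around \<open>\<phi>0\<close> inside the unit ball, where \<open>f\<close> is known to be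
    continuous.\<close>
  define \<phi>0 where "\<phi>0 = (1 / (2 * norm \<phi>1)) *\<^sub>R \<phi>1"
  have norm0: "norm \<phi>0 = 1 / 2" using \<open>\<phi>1 \<noteq> 0\<close> by (simp add: \<phi>0_def)
  have pos0: "f \<phi>0 > 0" using hom[of "1 / (2 * norm \<phi>1)" \<phi>1] \<phi>1 \<open>\<phi>1 \<noteq> 0\<close> by (simp add: \<phi>0_def)
  define \<epsilon> where "\<epsilon> = f \<phi>0 / 2"
  have "\<epsilon> > 0" using pos0 by (simp add: \<epsilon>_def)
  have "\<phi>0 \<in> cball 0 1" using norm0 by simp
  then obtain d where d: "d > 0"
    "\<And>\<psi>. \<psi> \<in> cball 0 1 \<Longrightarrow> dist \<psi> \<phi>0 < d \<Longrightarrow> dist (f \<psi>) (f \<phi>0) < \<epsilon>"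
    using FBL_continuous[OF p f(1)] \<open>\<epsilon> > 0\<close> unfolding continuous_on_iff by meson
  define r where "r = min d (1/2)"
  have "r > 0" using d(1) by (simp add: r_def)
  have near: "f \<psi> > \<epsilon>" if "norm (\<psi> - \<phi>0) < r" for \<psi>
  proof -
    have "norm \<psi> \<le> norm (\<psi> - \<phi>0) + norm \<phi>0" using norm_triangle_sub[of \<psi> \<phi>0] by simp
    then have "\<psi> \<in> cball 0 1" using norm0 that by (simp add: r_def)
    moreover have "dist \<psi> \<phi>0 < d" using that by (simp add: r_def dist_norm)
    ultimately have "dist (f \<psi>) (f \<phi>0) < \<epsilon>" by (rule d(2))
    then show ?thesis using pos0 unfolding dist_real_def \<epsilon>_def by linarith
  qed
  obtain B where B: "B \<subseteq> X" "independent B" "X \<subseteq> span B"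
    using maximal_independent_subset by blast
  have "finite B" using B(1) X(1) finite_subset by auto
  moreover have "span B = UNIV"
    using span_mono[OF B(3)] X(2) by (auto simp: span_span)
  ultimately obtain C where C: "C > 0" "\<And>\<phi> :: 'a \<Rightarrow>\<^sub>L real. norm \<phi> \<le> C * (\<Sum>b\<in>B. \<bar>blinfun_apply \<phi> b\<bar>)"
    using dual_norm_le_basis_sum B(2) by blast
  have "\<exists>x. blinfun_apply \<phi>0 x \<noteq> 0"
  proof (rule ccontr)
    assume "\<not> ?thesis"
    then have "\<phi>0 = 0" by (intro blinfun_eqI) (simp add: blinfun.zero_left)
    then show False using norm0 by simp
  qed
  then obtain x where x: "blinfun_apply \<phi>0 x \<noteq> 0" by blast
  \<comment> \<open>With this normalisation \<open>\<phi> x0\<close> is the coordinate along the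
    ray, and \<open>\<phi>0 x0 = 1\<close> gives \<open>D \<phi>0 = 0\<close> below.\<close>
  define x0 where "x0 = (1 / blinfun_apply \<phi>0 x) *\<^sub>R x"
  have x0: "blinfun_apply \<phi>0 x0 = 1" using x by (simp add: x0_def blinfun.scaleR_right)
  \<comment> \<open>\<open>D\<close> measures how far \<open>\<phi>\<close> is from the ray through \<open>\<phi>0\<close>.\<close>
  define D where "D \<phi> = (\<Sum>b\<in>B. \<bar>blinfun_apply \<phi> b - blinfun_apply \<phi>0 b * blinfun_apply \<phi> x0\<bar>)" for \<phi>
  \<comment> \<open>The slope \<open>C / r\<close> is chosen so that positivity of \<open>g\<close>
    forces \<open>C * D \<phi> / t < r\<close>, where \<open>t = \<phi> x0\<close>.\<close>
  define g where "g \<phi> = \<epsilon> * max 0 (blinfun_apply \<phi> x0 - C / r * D \<phi>)" for \<phi>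
  have "g \<in> FVL"
    unfolding g_def D_def
    by (intro FVL_scale FVL_pos_part FVL_diff FVL_sum FVL_abs FVL_apply)
  moreover have "(\<lambda>_. 0) < g"
  proof -
    have "(\<lambda>_. 0) \<le> g" using \<open>\<epsilon> > 0\<close> by (simp add: le_fun_def g_def)
    moreover have "g \<phi>0 > 0" using x0 \<open>\<epsilon> > 0\<close> by (simp add: g_def D_def)
    ultimately show ?thesis by (metis less_le less_irrefl)
  qed
  moreover have "g \<phi> \<le> f \<phi>" for \<phi>
  proof (cases "blinfun_apply \<phi> x0 - C / r * D \<phi> > 0")
    case False
    then show ?thesis using nonneg by (simp add: g_def)
  next
    case True
    define t where "t = blinfun_apply \<phi> x0"
    have D: "D \<phi> \<ge> 0" by (simp add: D_def sum_nonneg)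
    then have "C / r * D \<phi> \<ge> 0" using C(1) \<open>r > 0\<close> by simp
    then have t: "t > 0" "C / r * D \<phi> < t" using True by (auto simp: t_def)
    have "\<bar>blinfun_apply ((1 / t) *\<^sub>R \<phi> - \<phi>0) b\<bar>
        = (1 / t) * \<bar>blinfun_apply \<phi> b - blinfun_apply \<phi>0 b * t\<bar>" for b
    proof -
      have "blinfun_apply ((1 / t) *\<^sub>R \<phi> - \<phi>0) b
        = (1 / t) * (blinfun_apply \<phi> b - blinfun_apply \<phi>0 b * t)"
        using t(1) by (simp add: blinfun.diff_left blinfun.scaleR_left field_simps)
      then show ?thesis using t(1) by (simp add: abs_mult)
    qed
    then have "(\<Sum>b\<in>B. \<bar>blinfun_apply ((1 / t) *\<^sub>R \<phi> - \<phi>0) b\<bar>) = (1 / t) * D \<phi>"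
      by (simp add: D_def t_def sum_distrib_left)
    then have "norm ((1 / t) *\<^sub>R \<phi> - \<phi>0) \<le> C * ((1 / t) * D \<phi>)"
      using C(2)[of "(1 / t) *\<^sub>R \<phi> - \<phi>0"] by simp
    also have "\<dots> < r" using t \<open>r > 0\<close> by (simp add: field_simps)
    finally have "f ((1 / t) *\<^sub>R \<phi>) > \<epsilon>" by (rule near)
    then have "f \<phi> > \<epsilon> * t" using t(1) hom[of "1 / t" \<phi>] by (simp add: field_simps)
    moreover have "g \<phi> \<le> \<epsilon> * t"
      unfolding g_def using \<open>\<epsilon> > 0\<close> t \<open>C / r * D \<phi> \<ge> 0\<close>
      by (intro mult_left_mono) (auto simp: t_def)
    ultimately show ?thesis by simp
  qed
  ultimately show ?thesis by (auto simp: le_fun_def)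
qed

section \<open>The infinite-dimensional case\<close>

text \<open>The vectors are normalised members of an infinite Hamel basis; the span of a finite set
  contains no infinite independent set.\<close>

lemma independent_unit_sequence:
  assumes "\<not> (\<exists>B :: 'a::real_normed_vector set. finite B \<and> span B = UNIV)"
  obtains e :: "nat \<Rightarrow> 'a::real_normed_vector" where "\<And>n. norm (e n) = 1" "\<And>X. finite X \<Longrightarrow> \<exists>n. e n \<notin> span X"
proof -
  obtain B :: "'a set" where B: "independent B" "UNIV \<subseteq> span B"
    using maximal_independent_subset by metis
  then have "infinite B" using assms by auto
  then obtain b :: "nat \<Rightarrow> 'a" where b: "inj b" "range b \<subseteq> B"
    using infinite_countable_subset by blast
  have ind: "independent (range b)" using B(1) b(2) independent_mono by blast
  have nz: "b n \<noteq> 0" for n using ind dependent_zero by (metis rangeI)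
  define e where "e n = (1 / norm (b n)) *\<^sub>R b n" for n
  have "\<exists>n. e n \<notin> span X" if "finite X" for X
  proof (rule ccontr)
    assume "\<not> ?thesis"
    then have "b n \<in> span X" for n
      using span_scale[of "e n" X "norm (b n)"] nz[of n] by (simp add: e_def)
    then have "finite (range b)" using independent_span_bound[OF that ind] by blast
    then show False using b(1) finite_imageD by blast
  qed
  moreover have "norm (e n) = 1" for n using nz by (simp add: e_def)
  ultimately show ?thesis using that by blast
qed

text \<open>The weights sum to \<open>1/3\<close>, and each unit vector contributes at most
  \<open>norm \<phi>\<close>.\<close>

lemma dual_series:
  fixes \<phi> :: "'a::real_normed_vector \<Rightarrow>\<^sub>L real"
  assumes "\<And>n. norm (e n) = 1"
  shows "summable (\<lambda>n. (1/4)^Suc n * \<bar>blinfun_apply \<phi> (e n)\<bar>)"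
    and "(\<Sum>n. (1/4)^Suc n * \<bar>blinfun_apply \<phi> (e n)\<bar>) \<le> norm \<phi>"
proof -
  have le: "(1/4)^Suc n * \<bar>blinfun_apply \<phi> (e n)\<bar> \<le> (1/4)^Suc n * norm \<phi>" for n
    using norm_blinfun[of \<phi> "e n"] assms by (intro mult_left_mono) auto
  have "(\<lambda>n. (1/4::real)^Suc n) sums (1/3)"
    using sums_mult[OF geometric_sums[of "1/4::real"], of "1/4"] by simp
  then have sums: "(\<lambda>n. (1/4)^Suc n * norm \<phi>) sums (1/3 * norm \<phi>)" by (rule sums_mult2)
  show 1: "summable (\<lambda>n. (1/4)^Suc n * \<bar>blinfun_apply \<phi> (e n)\<bar>)"
    by (rule summable_comparison_test'[OF sums_summable[OF sums], of 0]) (use le in auto)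
  have "(\<Sum>n. (1/4)^Suc n * \<bar>blinfun_apply \<phi> (e n)\<bar>) \<le> 1/3 * norm \<phi>"
    using suminf_le[OF le 1 sums_summable[OF sums]] sums_unique[OF sums] by simp
  also have "\<dots> \<le> norm \<phi>" by simp
  finally show "(\<Sum>n. (1/4)^Suc n * \<bar>blinfun_apply \<phi> (e n)\<bar>) \<le> norm \<phi>" .
qed

text \<open>Truncating the series after \<open>N\<close> terms gives an element of
  \<open>FVL\<close>. The error is at most the tail, which is \<open>(1/4)^N\<close> times a series
  of the same shape along the shifted sequence.\<close>

lemma FBL_series_function:
  fixes u :: "'a::banach"
  assumes p: "1 \<le> p" and e: "\<And>n. norm (e n) = 1"
  shows "(\<lambda>\<phi>. max 0 (\<bar>blinfun_apply \<phi> u\<bar> - (\<Sum>n. (1/4)^Suc n * \<bar>blinfun_apply \<phi> (e n)\<bar>))) \<in> FBL p"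
    (is "?f \<in> _")
proof -
  let ?S = "\<lambda>\<phi> :: 'a \<Rightarrow>\<^sub>L real. \<Sum>n. (1/4)^Suc n * \<bar>blinfun_apply \<phi> (e n)\<bar>"
  note summable = dual_series(1)[of e, OF e]
  have S_nonneg: "?S \<phi> \<ge> 0" for \<phi> by (rule suminf_nonneg[OF summable]) simp
  have "?S (c *\<^sub>R \<phi>) = c * ?S \<phi>" if "c \<ge> 0" for c \<phi>
    using that suminf_mult[OF summable, of c \<phi>]
    by (simp add: blinfun.scaleR_left abs_mult mult.left_commute)
  then have "?f \<in> pos_homogeneous"
    unfolding pos_homogeneous_def
    by (simp add: blinfun.scaleR_left abs_mult max_mult_distrib_left right_diff_distrib del: power_Suc)
  moreover have "FBL_norm p ?f < \<infinity>"
  proof -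
    \<comment> \<open>Since the series is nonnegative, \<open>?f\<close> lies between 0 and the
      absolute value of \<open>eval_at u\<close>; the second summand is the zero function.\<close>
    have "FBL_norm p ?f \<le> ennreal (4 * (norm u + 0))"
    proof (rule FBL_norm_add_le[OF p norm_ge_zero order_refl FBL_norm_eval_at_le[OF p]])
      show "FBL_norm p (\<lambda>_. 0) \<le> ennreal 0" by (simp add: FBL_norm_zero)
      show "\<bar>?f \<phi>\<bar> \<le> \<bar>eval_at u \<phi>\<bar> + \<bar>0\<bar>" for \<phi>
        using S_nonneg[of \<phi>] by (simp add: eval_at_def)
    qed
    then show ?thesis by (auto simp: less_top[symmetric] top_unique)
  qed
  moreover have "\<exists>g\<in>FVL. FBL_norm p (\<lambda>\<phi>. ?f \<phi> - g \<phi>) < \<epsilon>" if "\<epsilon> > 0" for \<epsilon>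
  proof -
    have "(\<lambda>N. ennreal ((1/4)^N)) \<longlonglongrightarrow> ennreal 0"
      by (intro tendsto_ennrealI LIMSEQ_realpow_zero) auto
    then have "eventually (\<lambda>N. ennreal ((1/4)^N) < \<epsilon>) sequentially"
      using order_tendstoD(2) that by force
    then obtain N where N: "ennreal ((1/4)^N) < \<epsilon>"
      using eventually_happens trivial_limit_sequentially by blast
    define P where "P \<phi> = (\<Sum>n<N. (1/4)^Suc n * \<bar>blinfun_apply \<phi> (e n)\<bar>)" for \<phi> :: "'a \<Rightarrow>\<^sub>L real"
    define g where "g \<phi> = max 0 (\<bar>blinfun_apply \<phi> u\<bar> - P \<phi>)" for \<phi>
    have "g \<in> FVL"
      unfolding g_def P_def
      by (intro FVL_scale FVL_pos_part FVL_diff FVL_sum FVL_abs FVL_apply)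
    moreover have "FBL_norm p (\<lambda>\<phi>. ?f \<phi> - g \<phi>) \<le> ennreal ((1/4)^N)"
    proof (rule FBL_norm_series_le[OF p])
      show "norm (e (n + N)) \<le> 1" for n using e by simp
      fix \<phi> :: "'a \<Rightarrow>\<^sub>L real"
      have shift: "(1/4)^Suc (n + N) * \<bar>blinfun_apply \<phi> (e (n + N))\<bar>
          = (1/4)^N * ((1/4)^Suc n * \<bar>blinfun_apply \<phi> (e (n + N))\<bar>)" for n
        by (simp add: power_add)
      have "?S \<phi> = (\<Sum>n. (1/4)^Suc (n + N) * \<bar>blinfun_apply \<phi> (e (n + N))\<bar>) + P \<phi>"
        using suminf_split_initial_segment[OF summable[of \<phi>], of N] by (simp only: P_def)
      also have "(\<Sum>n. (1/4)^Suc (n + N) * \<bar>blinfun_apply \<phi> (e (n + N))\<bar>)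
          = (1/4)^N * (\<Sum>n. (1/4)^Suc n * \<bar>blinfun_apply \<phi> (e (n + N))\<bar>)"
        unfolding shift using e by (intro suminf_mult dual_series(1)) simp
      finally have split: "?S \<phi> = (1/4)^N * (\<Sum>n. (1/4)^Suc n * \<bar>blinfun_apply \<phi> (e (n + N))\<bar>) + P \<phi>" .
      have "(\<Sum>n. (1/4)^Suc n * \<bar>blinfun_apply \<phi> (e (n + N))\<bar>) \<ge> 0"
        using e by (intro suminf_nonneg dual_series(1)) auto
      then have "P \<phi> \<le> ?S \<phi>" unfolding split by simp
      \<comment> \<open>The positive part is 1-Lipschitz, so the error is at most the difference of
        the subtracted sums.\<close>
      then have "\<bar>?f \<phi> - g \<phi>\<bar> \<le> ?S \<phi> - P \<phi>" unfolding g_def by linarith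
      also have "\<dots> = (1/4)^N * (\<Sum>n. (1/4)^Suc n * \<bar>blinfun_apply \<phi> (e (n + N))\<bar>)"
        unfolding split by simp
      finally show "\<bar>?f \<phi> - g \<phi>\<bar> \<le> (1/4)^N * (\<Sum>n. (1/4)^Suc n * \<bar>blinfun_apply \<phi> (e (n + N))\<bar>)" .
    qed simp
    ultimately show ?thesis using N by (meson le_less_trans)
  qed
  ultimately show ?thesis unfolding FBL_def Hp_def by simp
qed

text \<open>The finite set determining \<open>g\<close> is not known when \<open>f\<close> is
  chosen. The series involves every \<open>e n\<close>, so whatever that set is, some
  \<open>e n\<close> escapes its span.\<close>

lemma not_order_dense_infinite_dimensional:
  assumes p: "1 \<le> p" and inf: "\<not> (\<exists>B :: 'a::banach set. finite B \<and> span B = UNIV)"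
  shows "\<not> order_dense (FVL :: (('a \<Rightarrow>\<^sub>L real) \<Rightarrow> real) set) (FBL p)"
proof
  assume dense: "order_dense (FVL :: (('a \<Rightarrow>\<^sub>L real) \<Rightarrow> real) set) (FBL p)"
  obtain e :: "nat \<Rightarrow> 'a" where e: "\<And>n. norm (e n) = 1" "\<And>X. finite X \<Longrightarrow> \<exists>n. e n \<notin> span X"
    using independent_unit_sequence[OF inf] by blast
  have "e 0 \<notin> span {}" using e(1)[of 0] by auto
  then obtain \<phi>0 :: "'a \<Rightarrow>\<^sub>L real" where \<phi>0: "blinfun_apply \<phi>0 (e 0) > 0"
    using separating_functional[of "{}" "e 0"] by blast
  \<comment> \<open>The factor makes \<open>\<phi>0 u = norm \<phi>0 + 1\<close>, which exceeds
    \<open>S \<phi>0\<close> by at least 1.\<close>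
  define u where "u = ((norm \<phi>0 + 1) / blinfun_apply \<phi>0 (e 0)) *\<^sub>R e 0"
  define S where "S \<phi> = (\<Sum>n. (1/4)^Suc n * \<bar>blinfun_apply \<phi> (e n)\<bar>)" for \<phi> :: "'a \<Rightarrow>\<^sub>L real"
  define f where "f \<phi> = max 0 (\<bar>blinfun_apply \<phi> u\<bar> - S \<phi>)" for \<phi>
  have "f \<in> FBL p"
    unfolding f_def S_def by (rule FBL_series_function[OF p e(1)])
  moreover have "(\<lambda>_. 0) < f"
  proof -
    have "blinfun_apply \<phi>0 u = norm \<phi>0 + 1" using \<phi>0 by (simp add: u_def blinfun.scaleR_right)
    moreover have "S \<phi>0 \<le> norm \<phi>0" unfolding S_def by (rule dual_series(2)[OF e(1)])
    ultimately have "f \<phi>0 > 0" by (simp add: f_def)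
    moreover have "(\<lambda>_. 0) \<le> f" by (simp add: le_fun_def f_def)
    ultimately show ?thesis by (metis less_le less_irrefl)
  qed
  ultimately obtain g where g: "g \<in> FVL" "(\<lambda>_. 0) < g" "g \<le> f"
    using dense unfolding order_dense_def by blast
  obtain X where X: "finite X"
    "\<And>\<phi> \<psi>. (\<And>x. x \<in> X \<Longrightarrow> blinfun_apply \<phi> x = blinfun_apply \<psi> x) \<Longrightarrow> g \<phi> = g \<psi>"
    using FVL_finitely_determined[OF g(1)] by blast
  \<comment> \<open>Including \<open>u\<close> keeps \<open>\<phi> u\<close> fixed under the
    perturbation, along with the values that determine \<open>g\<close>.\<close>
  obtain n where n: "e n \<notin> span (insert u X)" using e(2)[of "insert u X"] X(1) by blast
  obtain \<eta> :: "'a \<Rightarrow>\<^sub>L real" where \<eta>: "\<And>x. x \<in> insert u X \<Longrightarrow> blinfun_apply \<eta> x = 0"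
    "blinfun_apply \<eta> (e n) > 0"
    using separating_functional[OF _ n] X(1) by blast
  have "g \<phi> \<le> 0" for \<phi>
  proof -
    \<comment> \<open>The power of 4 undoes the weight of the \<open>n\<close>-th term, and the
      added \<open>\<bar>\<phi> (e n)\<bar>\<close> guards against cancellation with a negative
      \<open>\<phi> (e n)\<close>.\<close>
    define t where "t = (4^Suc n * \<bar>blinfun_apply \<phi> u\<bar> + \<bar>blinfun_apply \<phi> (e n)\<bar>) / blinfun_apply \<eta> (e n)"
    define \<psi> where "\<psi> = \<phi> + t *\<^sub>R \<eta>"
    have \<psi>: "blinfun_apply \<psi> x = blinfun_apply \<phi> x + t * blinfun_apply \<eta> x" for x
      by (simp add: \<psi>_def blinfun.add_left blinfun.scaleR_left)
    have "blinfun_apply \<psi> (e n)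
        = blinfun_apply \<phi> (e n) + (4^Suc n * \<bar>blinfun_apply \<phi> u\<bar> + \<bar>blinfun_apply \<phi> (e n)\<bar>)"
      using \<eta>(2) by (simp add: \<psi> t_def)
    then have "4^Suc n * \<bar>blinfun_apply \<phi> u\<bar> \<le> \<bar>blinfun_apply \<psi> (e n)\<bar>" by linarith
    then have "(1/4)^Suc n * (4^Suc n * \<bar>blinfun_apply \<phi> u\<bar>) \<le> (1/4)^Suc n * \<bar>blinfun_apply \<psi> (e n)\<bar>"
      by (intro mult_left_mono) auto
    then have "\<bar>blinfun_apply \<phi> u\<bar> \<le> (1/4)^Suc n * \<bar>blinfun_apply \<psi> (e n)\<bar>"
      by (simp only: mult.assoc[symmetric] power_mult_distrib[symmetric]) simp
    also have "\<dots> \<le> S \<psi>"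
      unfolding S_def using sum_le_suminf[OF dual_series(1)[OF e(1)], of "{n}" \<psi>] by simp
    finally have "\<bar>blinfun_apply \<psi> u\<bar> \<le> S \<psi>" using \<eta>(1)[of u] by (simp add: \<psi>)
    then have "f \<psi> = 0" by (simp add: f_def)
    moreover have "g \<phi> = g \<psi>" using \<eta>(1) by (intro X(2)) (simp add: \<psi>)
    ultimately show ?thesis using g(3) by (metis le_fun_def)
  qed
  then have "g \<le> (\<lambda>_. 0)" by (simp add: le_fun_def)
  then show False using g(2) by (simp add: less_le_not_le)
qed

theorem theorem5:
  fixes p :: ennreal
  assumes "1 \<le> p"
  shows "order_dense (FVL :: (('a::banach \<Rightarrow>\<^sub>L real) \<Rightarrow> real) set) (FBL p) \<longleftrightarrow>
         (\<exists>B :: 'a set. finite B \<and> span B = UNIV)"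
proof
  show "\<exists>B :: 'a set. finite B \<and> span B = UNIV"
    if "order_dense (FVL :: (('a \<Rightarrow>\<^sub>L real) \<Rightarrow> real) set) (FBL p)"
    using not_order_dense_infinite_dimensional[OF assms] that by blast
next
  assume "\<exists>B :: 'a set. finite B \<and> span B = UNIV"
  then obtain B :: "'a set" where B: "finite B" "span B = UNIV" by blast
  \<comment> \<open>The ambient set enters \<open>vector_sublattice\<close> only through the
    inclusion, so \<open>pos_homogeneous\<close> can be replaced by \<open>FBL p\<close>.\<close>
  have "vector_sublattice (FVL :: (('a \<Rightarrow>\<^sub>L real) \<Rightarrow> real) set) (FBL p)"
    using vector_sublattice_FVL FVL_subset_FBL[OF assms] unfolding vector_sublattice_def by blast
  then show "order_dense (FVL :: (('a \<Rightarrow>\<^sub>L real) \<Rightarrow> real) set) (FBL p)"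
    unfolding order_dense_def using FBL_minorant_finite_dimensional[OF assms B] by blast
qed

end
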